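(* Let $\rho_0:\mathbb{N}\to[0,\infty)$ satisfy $m_2(\rho_0)=\sum_{j=1}^\infty j^2\rho_0(j)<+\infty$ and $m_1(\rho_0)=\sum_{j=1}^\infty j\rho_0(j)>1$. Consider the discrete Coagulation-Fragmentation equation with coagulation kernel $a(j,k)=jk$ and fragmentation kernel $b(j,k)=1$ ($j,k\in\mathbb{N}$) and initial data $\rho_0$. Then there is no mass-conserving solution $\rho:\mathbb{N}\times[0,\infty)\to[0,\infty)$ to this equation for all time.
   Context: Here $\mathbb{N}=\{1,2,3,\dots\}$. The discrete Coagulation-Fragmentation equation with kernels $a(j,k)=jk$, $b(j,k)=1$ and initial data $\rho_0$ is, for $j\in\mathbb{N}$, $t>0$, $$\rho_t(j,t)=\frac12\sum_{k=1}^{j-1}(j-k)k\,\rho(j-k,t)\rho(k,t)-\rho(j,t)\sum_{k=1}^\infty jk\,\rho(k,t)-\frac12(j-1)\rho(j,t)+\sum_{k=1}^\infty\rho(j+k,t),\qquad \rho(j,0)=\rho_0(j).$$ A function $\rho:\mathbb{N}\times[0,\infty)\to[0,\infty)$ is called a solution if $\rho(\cdot,0)=\rho_0$ and for every bounded $g:\mathbb{N}\to\mathbb{R}$, $$\frac{d}{dt}\sum_{j=1}^\infty g(j)\rho(j,t)=\frac12\sum_{j=1}^\infty\sum_{k=1}^\infty\big(g(j+k)-g(j)-g(k)\big)jk\,\rho(j,t)\rho(k,t)-\frac12\sum_{j=1}^\infty\sum_{k=1}^{j-1}\big(g(j)-g(k)-g(j-k)\big)\rho(j,t).$$ The solution is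 mass-conserving (for all time) if $m_1(t)=\sum_{j=1}^\infty j\rho(j,t)$ equals $m_1(\rho_0)$ for all $t\ge0$. *)

theory Defs
  imports "HOL-Analysis.Analysis"
begin

text \<open>
  Densities on the positive integers are functions on \<open>nat\<close> of which only the values at
  \<open>j \<ge> 1\<close> matter; all sums range over \<open>{1..}\<close>.
\<close>

definition moment :: "nat \<Rightarrow> (nat \<Rightarrow> real) \<Rightarrow> real" where
  "moment p f = (\<Sum>\<^sub>\<infinity>j\<in>{1..}. real j ^ p * f j)"

definition coag_weak ::
  "(nat \<Rightarrow> nat \<Rightarrow> real) \<Rightarrow> (nat \<Rightarrow> real) \<Rightarrow> (nat \<Rightarrow> real) \<Rightarrow> real" where
  "coag_weak a g f =
     1 / 2 * (\<Sum>\<^sub>\<infinity>j\<in>{1..}. \<Sum>\<^sub>\<infinity>k\<in>{1..}. (g (j + k) - g j - g k) * a j k * f j * f k)"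

definition frag_weak ::
  "(nat \<Rightarrow> nat \<Rightarrow> real) \<Rightarrow> (nat \<Rightarrow> real) \<Rightarrow> (nat \<Rightarrow> real) \<Rightarrow> real" where
  "frag_weak b g f =
     1 / 2 * (\<Sum>\<^sub>\<infinity>j\<in>{1..}. \<Sum>k\<in>{1..<j}. (g j - g k - g (j - k)) * b (j - k) k * f j)"

text \<open>
  Convergence of the series in the weak equation. The library sums default to \<open>0\<close> on
  divergent series, so this must be required explicitly. For nonnegative \<open>f\<close> and kernels, the
  choice \<open>g = 1\<close> makes every term of each series of one sign, so over all bounded \<open>g\<close>
  unconditional summability is no more than ordinary convergence of the iterated series.
\<close>

definition weak_terms_summable ::
  "(nat \<Rightarrow> nat \<Rightarrow> real) \<Rightarrow> (nat \<Rightarrow> nat \<Rightarrow> real) \<Rightarrow> (nat \<Rightarrow> real) \<Rightarrow> (nat \<Rightarrow> real) \<Rightarrow> bool" where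
  "weak_terms_summable a b g f \<longleftrightarrow>
     (\<lambda>j. g j * f j) summable_on {1..} \<and>
     (\<lambda>(j, k). (g (j + k) - g j - g k) * a j k * f j * f k) summable_on ({1..} \<times> {1..}) \<and>
     (\<lambda>j. \<Sum>k\<in>{1..<j}. (g j - g k - g (j - k)) * b (j - k) k * f j) summable_on {1..}"

text \<open>
  \<open>\<rho> j t\<close> is the density of clusters of size \<open>j\<close> at time \<open>t\<close>. As for the strong equation, the
  weak equation is imposed for \<open>t > 0\<close>; continuity or one-sided differentiability at \<open>t = 0\<close> is
  not demanded, so solutions in any such stricter sense are included.
\<close>

definition coag_frag_solution ::
  "(nat \<Rightarrow> nat \<Rightarrow> real) \<Rightarrow> (nat \<Rightarrow> nat \<Rightarrow> real) \<Rightarrow> (nat \<Rightarrow> real) \<Rightarrow> (nat \<Rightarrow> real \<Rightarrow> real) \<Rightarrow> bool" where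
  "coag_frag_solution a b \<rho>0 \<rho> \<longleftrightarrow>
     (\<forall>j\<ge>1. \<forall>t\<ge>0. \<rho> j t \<ge> 0) \<and>
     (\<forall>j\<ge>1. \<rho> j 0 = \<rho>0 j) \<and>
     (\<forall>g. bounded (g ` {1..}) \<longrightarrow>
        (\<forall>t>0. weak_terms_summable a b g (\<lambda>j. \<rho> j t) \<and>
           ((\<lambda>s. \<Sum>\<^sub>\<infinity>j\<in>{1..}. g j * \<rho> j s) has_real_derivative
              coag_weak a g (\<lambda>j. \<rho> j t) - frag_weak b g (\<lambda>j. \<rho> j t)) (at t)))"

definition mass_conserving :: "(nat \<Rightarrow> real) \<Rightarrow> (nat \<Rightarrow> real \<Rightarrow> real) \<Rightarrow> bool" where
  "mass_conserving \<rho>0 \<rho> \<longleftrightarrow>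
     (\<forall>t\<ge>0. ((\<lambda>j. real j * \<rho> j t) has_sum moment 1 \<rho>0) {1..})"

end

theory Submission
  imports Defs
begin

text \<open>
  Test the weak equation with \<open>g = 1\<close>. For a solution of constant mass \<open>m\<close>, the number of
  clusters \<open>N\<close> satisfies \<open>N' = (m - m\<^sup>2 - N) / 2\<close>. Since \<open>N \<ge> 0\<close>, for \<open>m > 1\<close> it decreases at
  a rate bounded away from zero, so it becomes negative in finite time.
\<close>

text \<open>The weight \<open>1 - 1 - 1\<close> is -1 and the product kernel separates the
  variables: each inner sum is \<open>- m * (real j * f j)\<close>, and summing over
  \<open>j\<close> gives a second factor \<open>m\<close>.\<close>

lemma coag_weak_product_one:
  assumes "((\<lambda>j. real j * f j) has_sum m) {1..}"
  shows "coag_weak (\<lambda>j k. real j * real k) (\<lambda>_. 1) f = - (m\<^sup>2 / 2)"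
proof -
  have m: "(\<Sum>\<^sub>\<infinity>j\<in>{1..}. real j * f j) = m"
    using assms by (rule infsumI)
  have "(\<Sum>\<^sub>\<infinity>k\<in>{1..}. (1 - 1 - 1) * (real j * real k) * f j * f k) = - m * (real j * f j)" for j
  proof -
    have "(\<Sum>\<^sub>\<infinity>k\<in>{1..}. (1 - 1 - 1) * (real j * real k) * f j * f k)
        = (\<Sum>\<^sub>\<infinity>k\<in>{1..}. - (real j * f j) * (real k * f k))"
      by (rule infsum_cong) (simp add: mult_ac)
    then show ?thesis
      by (simp only: infsum_cmult_right' m) simp
  qed
  then show ?thesis
    unfolding coag_weak_def by (simp only: infsum_cmult_right' m) (simp add: power2_eq_square)
qed

text \<open>The inner sum has \<open>j - 1\<close> equal terms \<open>- f j\<close>, so it equals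
  \<open>f j - real j * f j\<close>, and the two parts sum to \<open>N\<close> and
  \<open>- m\<close>.\<close>

lemma frag_weak_constant_one:
  assumes m: "((\<lambda>j. real j * f j) has_sum m) {1..}" and N: "(f has_sum N) {1..}"
  shows "frag_weak (\<lambda>_ _. 1) (\<lambda>_. 1) f = - ((m - N) / 2)"
proof -
  have "((\<lambda>j. f j + - (real j * f j)) has_sum (N + - m)) {1..}"
    using N m by (intro has_sum_add has_sum_uminusI)
  then have "((\<lambda>j. \<Sum>k\<in>{1..<j}. (1 - 1 - 1) * 1 * f j) has_sum (N + - m)) {1..}"
    \<comment> \<open>Membership in \<open>{1..}\<close> makes the natural subtraction in the
      cardinality \<open>j - 1\<close> exact.\<close>
    by (rule has_sum_cong[THEN iffD1, rotated]) (auto simp: of_nat_diff algebra_simps)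
  then show ?thesis
    unfolding frag_weak_def by (simp only: infsumI) (simp add: field_simps)
qed

theorem theorem1p1:
  fixes \<rho>0 :: "nat \<Rightarrow> real"
  assumes "\<And>j. j \<ge> 1 \<Longrightarrow> \<rho>0 j \<ge> 0"
    and "(\<lambda>j. real j ^ 2 * \<rho>0 j) summable_on {1..}"
    and "moment 1 \<rho>0 > 1"
  shows "\<not> (\<exists>\<rho> :: nat \<Rightarrow> real \<Rightarrow> real.
      coag_frag_solution (\<lambda>j k. real j * real k) (\<lambda>j k. 1) \<rho>0 \<rho> \<and> mass_conserving \<rho>0 \<rho>)"
proof
  let ?a = "\<lambda>j k. real j * real k" and ?b = "\<lambda>(j::nat) (k::nat). 1 :: real"
  assume "\<exists>\<rho>. coag_frag_solution ?a ?b \<rho>0 \<rho> \<and> mass_conserving \<rho>0 \<rho>"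
  then obtain \<rho> where sol: "coag_frag_solution ?a ?b \<rho>0 \<rho>" and mc: "mass_conserving \<rho>0 \<rho>"
    by blast
  define m where "m = moment 1 \<rho>0"
  define N where "N t = (\<Sum>\<^sub>\<infinity>j\<in>{1..}. \<rho> j t)" for t
  \<comment> \<open>Coagulation contributes \<open>- (m\<^sup>2 / 2)\<close> and fragmentation
    \<open>(m - N t) / 2\<close>; \<open>- c\<close> is the part free of \<open>N t\<close>.\<close>
  define c where "c = (m\<^sup>2 - m) / 2"
  have "c > 0"
    using assms(3) by (simp add: c_def m_def power2_eq_square)
  have N_nonneg: "N t \<ge> 0" if "t \<ge> 0" for t
    using sol that unfolding N_def coag_frag_solution_def by (intro infsum_nonneg) auto
  have N_deriv: "(N has_real_derivative - c - N t / 2) (at t)" if "t > 0" for t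
  proof -
    have "bounded ((\<lambda>_::nat. 1::real) ` {1..})"
      by (auto intro: boundedI)
    with sol that have summable: "weak_terms_summable ?a ?b (\<lambda>_. 1) (\<lambda>j. \<rho> j t)"
      and deriv: "((\<lambda>s. \<Sum>\<^sub>\<infinity>j\<in>{1..}. 1 * \<rho> j s) has_real_derivative
        coag_weak ?a (\<lambda>_. 1) (\<lambda>j. \<rho> j t) - frag_weak ?b (\<lambda>_. 1) (\<lambda>j. \<rho> j t)) (at t)"
      unfolding coag_frag_solution_def by blast+
    have mass: "((\<lambda>j. real j * \<rho> j t) has_sum m) {1..}"
      using mc that by (simp add: mass_conserving_def m_def)
    \<comment> \<open>The summability clause for \<open>g = 1\<close> makes \<open>N t\<close> a
      genuine sum, not the default 0 of a divergent one.\<close>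
    have number: "((\<lambda>j. \<rho> j t) has_sum N t) {1..}"
      using summable by (simp add: weak_terms_summable_def N_def)
    have "coag_weak ?a (\<lambda>_. 1) (\<lambda>j. \<rho> j t) - frag_weak ?b (\<lambda>_. 1) (\<lambda>j. \<rho> j t) = - c - N t / 2"
      unfolding coag_weak_product_one[OF mass] frag_weak_constant_one[OF mass number]
      by (simp add: c_def field_simps)
    with deriv show ?thesis
      by (simp add: N_def[abs_def])
  qed
  \<comment> \<open>Chosen so that \<open>c * T = N 1 + c\<close>: a decrease at rate at least
    \<open>c\<close> during time \<open>T\<close> takes \<open>N\<close> from \<open>N 1\<close> to
    at most \<open>- c\<close>.\<close>
  define T where "T = N 1 / c + 1"
  have "T > 0"
    using \<open>c > 0\<close> N_nonneg[of 1] by (simp add: T_def add_nonneg_pos)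
  \<comment> \<open>The interval starts at time 1 because the equation holds only for positive times
    and \<open>N\<close> need not be continuous at 0.\<close>
  then obtain z where z: "1 < z" "N (1 + T) - N 1 = (1 + T - 1) * (- c - N z / 2)"
    using MVT2[of 1 "1 + T" N "\<lambda>t. - c - N t / 2"] N_deriv by auto
  \<comment> \<open>Since \<open>N z\<close> is nonnegative, the slope at \<open>z\<close> is at
    most \<open>- c\<close>.\<close>
  have "N (1 + T) - N 1 \<le> T * (- c)"
    unfolding z(2) add_diff_cancel_left'
    using z(1) \<open>T > 0\<close> N_nonneg[of z] by (intro mult_left_mono) auto
  also have "\<dots> = - N 1 - c"
    using \<open>c > 0\<close> by (simp add: T_def field_simps)
  finally show False
    using \<open>c > 0\<close> \<open>T > 0\<close> N_nonneg[of "1 + T"] by simp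
qed

end
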